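(* Let $t_0\in\mathbb{R}$, let $n\ge 1$, let $f:\mathbb{R}^n\times[t_0,\infty)\to\mathbb{R}^n$, $(x,t)\mapsto f(x,t)$, be continuously differentiable in $x$ and continuous in $t$, and let $\delta:[t_0,\infty)\to\mathbb{R}^n$ be continuous. Consider the system $$\dot x=f(x,t)+\delta(t),\qquad x\in\mathbb{R}^n,\quad t\ge t_0,$$ and assume that its solutions are uniquely determined by $x(t_0)$ for all $t\ge t_0$ (that is, for every initial value in $\mathbb{R}^n$ at time $t_0$ there is exactly one solution, and it is defined on all of $[t_0,\infty)$). Let $|\cdot|$ be some vector norm on $\mathbb{R}^n$, with associated logarithmic norm $\mu[\cdot]$, and assume: (A1) there exist a continuous function $\alpha:[t_0,\infty)\to\mathbb{R}$ and a real constant $\alpha_0>0$ such that $$\mu[J_xf(x,t)]\le-\alpha(t)\le-\alpha_0<0\quad\text{for all }(x,t)\in\mathbb{R}^n\times[t_0,\infty).$$ Then any two solutions $x(t)$ and $x^*(t)$ of the system satisfy $$|x(t)-x^*(t)|\le e^{-\alpha_0(t-t_0)}\,|x(t_0)-x^*(t_0)|,\qquad t\ge t_0;$$ that is, the system is globally incrementally stable (GIS). If, in addition, (A2) $\dfrac{|f(0,t)+\delta(t)|}{\alpha(t)}\to 0$ as $t\to\infty$, then all solutions $x(t)$ of the system converge to $0$ as $t\to\infty$.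
   Context: $J_xf(y,t)$ denotes the $n\times n$ Jacobian matrix of $f$ with respect to the variable $x$, evaluated at $(y,t)$. For a vector norm $|\cdot|$ on $\mathbb{R}^n$, the induced matrix norm is $\|A\|=\max\{|Ax|:\ |x|=1\}$, and the logarithmic norm of a real $n\times n$ matrix $A$ is $$\mu[A]=\lim_{\theta\to0^+}\frac{\|I+\theta A\|-1}{\theta},$$ where $I$ is the identity matrix (this limit always exists; $\mu[A]$ may be negative). A function $\beta:[0,\infty)\times[0,\infty)\to[0,\infty)$ is of class $\mathcal{KL}$ if it is continuous, for each fixed $s$ the map $r\mapsto\beta(r,s)$ is strictly increasing with $\beta(0,s)=0$, and for each fixed $r$ the map $s\mapsto\beta(r,s)$ is decreasing (non-increasing) with $\beta(r,s)\to0$ as $s\to\infty$. The system is globally incrementally stable (GIS) if there exists $\beta\in\mathcal{KL}$ such that for any two solutions $x(t)$, $x^*(t)$ with $x(t_0),x^*(t_0)\in\mathbb{R}^n$ and all $t\ge t_0$, $$|x(t)-x^*(t)|\le\beta\big(|x(t_0)-x^*(t_0)|,\,t-t_0\big).$$ The origin $x=0$ is not assumed to be an equilibrium of $\dot x=f(x,t)$ or of the full system. *)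

theory Defs
  imports "HOL-Analysis.Analysis"
begin

definition vector_norm :: "(real ^ 'n \<Rightarrow> real) \<Rightarrow> bool" where
  "vector_norm N \<longleftrightarrow>
     (\<forall>x. 0 \<le> N x) \<and>
     (\<forall>x. N x = 0 \<longleftrightarrow> x = 0) \<and>
     (\<forall>c x. N (c *\<^sub>R x) = \<bar>c\<bar> * N x) \<and>
     (\<forall>x y. N (x + y) \<le> N x + N y)"

text \<open>
  If \<open>N\<close> is a vector norm, its unit sphere is nonempty and compact, so the supremum below is a maximum.
\<close>

definition induced_matrix_norm :: "(real ^ 'n \<Rightarrow> real) \<Rightarrow> real ^ 'n ^ 'n \<Rightarrow> real" where
  "induced_matrix_norm N A = (SUP x\<in>{x. N x = 1}. N (A *v x))"

definition log_norm :: "(real ^ 'n \<Rightarrow> real) \<Rightarrow> real ^ 'n ^ 'n \<Rightarrow> real" where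
  "log_norm N A = Lim (at_right 0) (\<lambda>\<theta>. (induced_matrix_norm N (mat 1 + \<theta> *\<^sub>R A) - 1) / \<theta>)"

definition jacobian_x :: "(real ^ 'n \<Rightarrow> real \<Rightarrow> real ^ 'n) \<Rightarrow> real ^ 'n \<Rightarrow> real \<Rightarrow> real ^ 'n ^ 'n" where
  "jacobian_x f y t = jacobian (\<lambda>x. f x t) (at y)"

definition C1_in_x :: "(real ^ 'n \<Rightarrow> real \<Rightarrow> real ^ 'n) \<Rightarrow> real \<Rightarrow> bool" where
  "C1_in_x f t0 \<longleftrightarrow>
     (\<forall>t\<ge>t0. (\<forall>x. (\<lambda>x. f x t) differentiable (at x)) \<and>
              continuous_on UNIV (\<lambda>x. jacobian_x f x t))"

text \<open>
  The derivative at \<open>t0\<close> is one-sided; the values of \<open>x\<close> before \<open>t0\<close> are irrelevant.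
\<close>

definition solution :: "(real ^ 'n \<Rightarrow> real \<Rightarrow> real ^ 'n) \<Rightarrow> real \<Rightarrow> (real \<Rightarrow> real ^ 'n) \<Rightarrow> bool" where
  "solution g t0 x \<longleftrightarrow> (\<forall>t\<ge>t0. (x has_vector_derivative g (x t) t) (at t within {t0..}))"

text \<open>
  As solutions are total functions on the reals, uniqueness means agreement on \<open>[t0, \<infinity>)\<close>.
\<close>

definition uniquely_solvable :: "(real ^ 'n \<Rightarrow> real \<Rightarrow> real ^ 'n) \<Rightarrow> real \<Rightarrow> bool" where
  "uniquely_solvable g t0 \<longleftrightarrow>
     (\<forall>x0. \<exists>x. solution g t0 x \<and> x t0 = x0 \<and>
        (\<forall>y. solution g t0 y \<and> y t0 = x0 \<longrightarrow> (\<forall>t\<ge>t0. y t = x t)))"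

definition class_KL :: "(real \<Rightarrow> real \<Rightarrow> real) \<Rightarrow> bool" where
  "class_KL \<beta> \<longleftrightarrow>
     (\<forall>r\<ge>0. \<forall>s\<ge>0. 0 \<le> \<beta> r s) \<and>
     continuous_on ({0..} \<times> {0..}) (\<lambda>(r, s). \<beta> r s) \<and>
     (\<forall>s\<ge>0. strict_mono_on {0..} (\<lambda>r. \<beta> r s) \<and> \<beta> 0 s = 0) \<and>
     (\<forall>r\<ge>0. antimono_on {0..} (\<beta> r) \<and> (\<beta> r \<longlongrightarrow> 0) at_top)"

definition GIS :: "(real ^ 'n \<Rightarrow> real) \<Rightarrow> (real ^ 'n \<Rightarrow> real \<Rightarrow> real ^ 'n) \<Rightarrow> real \<Rightarrow> bool" where
  "GIS N g t0 \<longleftrightarrow>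
     (\<exists>\<beta>. class_KL \<beta> \<and>
        (\<forall>x y. solution g t0 x \<and> solution g t0 y \<longrightarrow>
           (\<forall>t\<ge>t0. N (x t - y t) \<le> \<beta> (N (x t0 - y t0)) (t - t0))))"

end

theory Submission
  imports Defs
begin

text \<open>
  The proof works with the one-sided directional derivative of \<open>N\<close> at \<open>e\<close>.  For a fixed time, the
  directions \<open>v\<close> along which it is at most \<open>c\<close> form a closed convex set.  With \<open>e = x - y\<close> and
  \<open>c = - \<alpha> N e\<close>, this set contains \<open>J e\<close> for every Jacobian \<open>J\<close> on the segment from \<open>y\<close> to \<open>x\<close>, hence,
  by the mean value theorem and separation by hyperplanes, also the difference of the values of \<open>f\<close>.
  So the distance of two solutions, or of a solution and \<open>0\<close>, satisfies a scalar Dini differential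
  inequality, which is integrated by comparison with a strict supersolution.
\<close>

section \<open>Vector norms on R^n and their equivalence with the Euclidean norm\<close>

lemma vector_normD:
  assumes "vector_norm N"
  shows "0 \<le> N x" "N x = 0 \<longleftrightarrow> x = 0" "N (c *\<^sub>R x) = \<bar>c\<bar> * N x" "N (x + y) \<le> N x + N y"
  using assms unfolding vector_norm_def by auto

text \<open>The triangle inequality and homogeneity make \<open>N\<close> convex, and a finite
  convex function on a finite-dimensional space is continuous.\<close>

lemma continuous_on_vector_norm:
  assumes "vector_norm N"
  shows "continuous_on UNIV N"
proof -
  note D = vector_normD[OF assms]
  have "convex_on UNIV N"
  proof (rule convex_onI)
    fix t :: real and x y
    assume "0 < t" "t < 1"
    then show "N ((1 - t) *\<^sub>R x + t *\<^sub>R y) \<le> (1 - t) * N x + t * N y"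
      using D(4)[of "(1 - t) *\<^sub>R x" "t *\<^sub>R y"] by (simp add: D(3))
  qed auto
  then show ?thesis
    by (intro convex_on_continuous) auto
qed

text \<open>The constants are the extreme values of \<open>N\<close> on the compact Euclidean unit
  sphere; homogeneity carries the bounds to all vectors.\<close>

lemma vector_norm_equiv:
  fixes N :: "real ^ 'n \<Rightarrow> real"
  assumes "vector_norm N"
  obtains m M where "m > 0" "M > 0" "\<And>x. m * norm x \<le> N x" "\<And>x. N x \<le> M * norm x"
proof -
  note D = vector_normD[OF assms]
  have cont: "continuous_on (sphere 0 1) N"
    using continuous_on_vector_norm[OF assms] by (rule continuous_on_subset) auto
  \<comment> \<open>The index type is nonempty, so any index, even \<open>undefined\<close>, gives a
    unit vector.\<close>
  have "axis undefined 1 \<in> (sphere 0 1 :: (real ^ 'n) set)"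
    by (simp add: norm_axis_1)
  then have ne: "(sphere 0 1 :: (real ^ 'n) set) \<noteq> {}"
    by blast
  obtain u where u: "u \<in> sphere 0 1" "\<And>x. x \<in> sphere 0 1 \<Longrightarrow> N u \<le> N x"
    using continuous_attains_inf[OF compact_sphere ne cont] by blast
  obtain v where v: "v \<in> sphere 0 1" "\<And>x. x \<in> sphere 0 1 \<Longrightarrow> N x \<le> N v"
    using continuous_attains_sup[OF compact_sphere ne cont] by blast
  have eq: "N x = norm x * N (sgn x)" for x
    using D(3)[of "norm x" "sgn x"] by (cases "x = 0") (auto simp: sgn_div_norm D)
  show thesis
  proof
    show "N u > 0"
      using D(1)[of u] D(2)[of u] u(1) by auto
    then show "N v > 0"
      using u(2)[OF v(1)] by linarith
    have sg: "sgn x \<in> sphere 0 1" if "x \<noteq> 0" for x :: "real ^ 'n"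
      using that by (simp add: norm_sgn)
    show "N u * norm x \<le> N x" for x
      by (cases "x = 0") (auto simp: D D(2)[of 0, simplified] eq[of x] mult.commute intro!: mult_left_mono u(2) sg)
    show "N x \<le> N v * norm x" for x
      by (cases "x = 0") (auto simp: D D(2)[of 0, simplified] eq[of x] mult.commute intro!: mult_left_mono v(2) sg)
  qed
qed

lemma unit_vector_exists:
  fixes N :: "real ^ 'n \<Rightarrow> real"
  assumes "vector_norm N"
  obtains u where "N u = 1"
proof -
  note D = vector_normD[OF assms]
  define a :: "real ^ 'n" where "a = axis undefined 1"
  have "a \<noteq> 0"
    unfolding a_def by simp
  then have "N ((1 / N a) *\<^sub>R a) = 1"
    using D(1,2)[of a] by (simp add: D(3))
  then show thesis ..
qed

section \<open>The induced matrix norm\<close>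

text \<open>Boundedness is what makes the \<open>SUP\<close> in \<open>induced_matrix_norm\<close> a
  genuine least upper bound, since suprema of reals are otherwise unspecified.\<close>

lemma induced_matrix_norm_bdd:
  fixes N :: "real ^ 'n \<Rightarrow> real"
  assumes "vector_norm N"
  shows "bdd_above ((\<lambda>x. N (A *v x)) ` {x. N x = 1})"
proof -
  obtain m M where mM: "m > 0" "M > 0" "\<And>x. m * norm x \<le> N x" "\<And>x. N x \<le> M * norm x"
    using vector_norm_equiv[OF assms] by blast
  have "bounded_linear ((*v) A)"
    by (rule matrix_vector_mul_bounded_linear)
  then obtain K where K: "K > 0" "\<And>x. norm (A *v x) \<le> norm x * K"
    using bounded_linear.pos_bounded by blast
  show ?thesis
  proof (rule bdd_aboveI2)
    fix x assume "x \<in> {x. N x = 1}"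
    then have "norm x \<le> 1 / m"
      using mM(1) mM(3)[of x] by (simp add: field_simps)
    then have "norm (A *v x) \<le> 1 / m * K"
      using K(2)[of x] K(1) by (meson mult_right_mono less_imp_le order_trans)
    then show "N (A *v x) \<le> M * (1 / m * K)"
      using mM(4)[of "A *v x"] mM(2) by (meson mult_left_mono less_imp_le order_trans)
  qed
qed

lemma induced_matrix_norm_le:
  assumes "vector_norm N"
  shows "N (A *v x) \<le> induced_matrix_norm N A * N x"
proof (cases "x = 0")
  case True
  then show ?thesis
    using vector_normD(2)[OF assms, of 0] by simp
next
  case False
  note D = vector_normD[OF assms]
  have pos: "N x > 0"
    using False D(1,2)[of x] by auto
  define u where "u = (1 / N x) *\<^sub>R x"
  have "N u = 1"
    using pos by (simp add: u_def D(3))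
  then have "N (A *v u) \<le> induced_matrix_norm N A"
    unfolding induced_matrix_norm_def
    by (intro cSUP_upper induced_matrix_norm_bdd assms) auto
  moreover have "N (A *v u) = N (A *v x) / N x"
    using pos by (simp add: u_def matrix_vector_mult_scaleR D(3))
  ultimately show ?thesis
    using pos by (simp add: field_simps)
qed

lemma induced_matrix_norm_leI:
  assumes "vector_norm N" "\<And>x. N x = 1 \<Longrightarrow> N (A *v x) \<le> c"
  shows "induced_matrix_norm N A \<le> c"
proof -
  obtain u where "N u = 1"
    using unit_vector_exists[OF assms(1)] by blast
  then show ?thesis
    unfolding induced_matrix_norm_def by (intro cSUP_least) (auto intro: assms(2))
qed

lemma mat_1_scaleR_mult_vec:
  fixes A :: "real ^ 'n ^ 'n"
  shows "(mat 1 + \<theta> *\<^sub>R A) *v x = x + \<theta> *\<^sub>R (A *v x)"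
  by (simp add: matrix_vector_mult_add_rdistrib scaleR_matrix_vector_assoc)

section \<open>Existence of the limit that defines the logarithmic norm\<close>

text \<open>For \<open>h \<le> k\<close>, the matrix I + hA is the convex combination of I and I +
  kA with weights 1 - h/k and h/k, so the quotients inherit monotonicity from convexity of the
  norm.\<close>

lemma log_norm_quotient_mono:
  fixes N :: "real ^ 'n \<Rightarrow> real"
  assumes N: "vector_norm N" and hk: "0 < h" "h \<le> k"
  shows "(induced_matrix_norm N (mat 1 + h *\<^sub>R A) - 1) / h
         \<le> (induced_matrix_norm N (mat 1 + k *\<^sub>R A) - 1) / k"
proof -
  note D = vector_normD[OF N]
  let ?n = "\<lambda>h. induced_matrix_norm N (mat 1 + h *\<^sub>R A)"
  have "?n h \<le> (1 - h / k) + h / k * ?n k"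
  proof (rule induced_matrix_norm_leI[OF N])
    fix x assume x: "N x = 1"
    have "x + h *\<^sub>R (A *v x) = (1 - h / k) *\<^sub>R x + (h / k) *\<^sub>R (x + k *\<^sub>R (A *v x))"
      using hk by (simp add: algebra_simps)
    then have "N (x + h *\<^sub>R (A *v x)) \<le> \<bar>1 - h / k\<bar> * N x + \<bar>h / k\<bar> * N (x + k *\<^sub>R (A *v x))"
      using D(4)[of "(1 - h / k) *\<^sub>R x" "(h / k) *\<^sub>R (x + k *\<^sub>R (A *v x))"] by (simp only: D(3))
    moreover have "N (x + k *\<^sub>R (A *v x)) \<le> ?n k"
      using induced_matrix_norm_le[OF N, of "mat 1 + k *\<^sub>R A" x] x by (simp add: mat_1_scaleR_mult_vec)
    then have "\<bar>h / k\<bar> * N (x + k *\<^sub>R (A *v x)) \<le> h / k * ?n k"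
      using hk by (simp add: mult_left_mono divide_right_mono)
    moreover have "\<bar>1 - h / k\<bar> = 1 - h / k"
      using hk by simp
    ultimately show "N ((mat 1 + h *\<^sub>R A) *v x) \<le> (1 - h / k) + h / k * ?n k"
      using x by (simp add: mat_1_scaleR_mult_vec)
  qed
  then have "?n h - 1 \<le> h * ((?n k - 1) / k)"
    by (simp add: algebra_simps diff_divide_distrib)
  then show ?thesis
    using hk by (simp add: pos_divide_le_eq mult.commute)
qed

text \<open>The reverse triangle inequality at a single unit vector gives a bound independent of
  \<open>h\<close>; together with monotonicity it forces convergence as \<open>h\<close> decreases
  to 0.\<close>

lemma log_norm_quotient_lower:
  fixes N :: "real ^ 'n \<Rightarrow> real"
  assumes N: "vector_norm N" and h: "0 < h"
  shows "- induced_matrix_norm N A \<le> (induced_matrix_norm N (mat 1 + h *\<^sub>R A) - 1) / h"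
proof -
  note D = vector_normD[OF N]
  obtain u where u: "N u = 1"
    using unit_vector_exists[OF N] by blast
  have "N u \<le> N (u + h *\<^sub>R (A *v u)) + N ((- h) *\<^sub>R (A *v u))"
    using D(4)[of "u + h *\<^sub>R (A *v u)" "(- h) *\<^sub>R (A *v u)"] by simp
  moreover have "N (u + h *\<^sub>R (A *v u)) \<le> induced_matrix_norm N (mat 1 + h *\<^sub>R A)"
    using induced_matrix_norm_le[OF N, of "mat 1 + h *\<^sub>R A" u] u by (simp add: mat_1_scaleR_mult_vec)
  moreover have "N ((- h) *\<^sub>R (A *v u)) \<le> h * induced_matrix_norm N A"
    using induced_matrix_norm_le[OF N, of A u] u h by (simp only: D(3)) simp
  ultimately show ?thesis
    using u h by (simp add: field_simps)
qed

lemma tendsto_at_right_mono: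
  fixes r :: "real \<Rightarrow> real"
  assumes mono: "\<And>h k. a < h \<Longrightarrow> h \<le> k \<Longrightarrow> r h \<le> r k" and lower: "\<And>h. a < h \<Longrightarrow> b \<le> r h"
  shows "(r \<longlongrightarrow> (INF h\<in>{a<..}. r h)) (at_right a)"
proof (rule order_tendstoI)
  have bdd: "bdd_below (r ` {a<..})"
    by (rule bdd_belowI2[of _ b]) (auto intro: lower)
  show "\<forall>\<^sub>F h in at_right a. y < r h" if "y < (INF h\<in>{a<..}. r h)" for y
    using eventually_at_right_less[of a]
    by eventually_elim (use that cINF_lower[OF bdd] in force)
  show "\<forall>\<^sub>F h in at_right a. r h < y" if y: "(INF h\<in>{a<..}. r h) < y" for y
  proof -
    obtain k where k: "a < k" "r k < y"
      using y cINF_less_iff[OF _ bdd, of y] by auto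
    then have "\<forall>\<^sub>F h in at_right a. h \<in> {a<..<k}"
      by (intro eventually_at_right_real)
    then show ?thesis
      by eventually_elim (use mono[OF _ less_imp_le] k in \<open>force intro: le_less_trans\<close>)
  qed
qed

text \<open>\<open>Lim\<close> carries information only when a limit exists. Here the monotone
  quotients converge to their infimum, which therefore is \<open>log_norm\<close>.\<close>

lemma tendsto_log_norm:
  fixes N :: "real ^ 'n \<Rightarrow> real"
  assumes N: "vector_norm N"
  shows "((\<lambda>\<theta>. (induced_matrix_norm N (mat 1 + \<theta> *\<^sub>R A) - 1) / \<theta>) \<longlongrightarrow> log_norm N A) (at_right 0)"
  (is "(?r \<longlongrightarrow> _) _")
proof -
  have "(?r \<longlongrightarrow> (INF h\<in>{0<..}. ?r h)) (at_right 0)"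
    by (rule tendsto_at_right_mono[OF log_norm_quotient_mono[OF N] log_norm_quotient_lower[OF N]])
  moreover from this have "log_norm N A = (INF h\<in>{0<..}. ?r h)"
    unfolding log_norm_def by (intro tendsto_Lim) auto
  ultimately show ?thesis
    by simp
qed

section \<open>One-sided directional derivatives of a vector norm\<close>

text \<open>This bounds the upper right Dini derivative at 0 of the map from \<open>h\<close> to
  \<open>N (e + h *\<^sub>R v)\<close>. The epsilon form avoids speaking of the derivative
  itself.\<close>

definition dir_deriv_le :: "(real ^ 'n \<Rightarrow> real) \<Rightarrow> real ^ 'n \<Rightarrow> real ^ 'n \<Rightarrow> real \<Rightarrow> bool" where
  "dir_deriv_le N e v c \<longleftrightarrow> (\<forall>\<epsilon>>0. \<forall>\<^sub>F h in at_right 0. N (e + h *\<^sub>R v) \<le> N e + h * (c + \<epsilon>))"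

text \<open>The vector e + hAe is (I + hA)e, so its norm is at most the matrix norm of I + hA times
  \<open>N e\<close>, and the limit defining \<open>log_norm\<close> controls that factor to first
  order in \<open>h\<close>.\<close>

lemma dir_deriv_le_log_norm:
  fixes N :: "real ^ 'n \<Rightarrow> real"
  assumes N: "vector_norm N" and le: "log_norm N A \<le> c"
  shows "dir_deriv_le N e (A *v e) (c * N e)"
  unfolding dir_deriv_le_def
proof (intro allI impI)
  fix \<epsilon> :: real assume "\<epsilon> > 0"
  note D = vector_normD[OF N]
  let ?n = "\<lambda>h. induced_matrix_norm N (mat 1 + h *\<^sub>R A)"
  \<comment> \<open>The summand 1 keeps the denominator positive when \<open>e = 0\<close>.\<close>
  define \<eta> where "\<eta> = \<epsilon> / (N e + 1)"
  have \<eta>: "\<eta> > 0" "\<eta> * N e \<le> \<epsilon>"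
    using \<open>\<epsilon> > 0\<close> D(1)[of e] by (auto simp: \<eta>_def field_simps)
  then have "\<forall>\<^sub>F h in at_right 0. (?n h - 1) / h < c + \<eta>"
    using le by (intro order_tendstoD(2)[OF tendsto_log_norm[OF N]]) auto
  then show "\<forall>\<^sub>F h in at_right 0. N (e + h *\<^sub>R (A *v e)) \<le> N e + h * (c * N e + \<epsilon>)"
    using eventually_at_right_less[of 0]
  proof eventually_elim
    case (elim h)
    then have "?n h \<le> 1 + h * (c + \<eta>)"
      by (simp add: field_simps)
    then have "?n h * N e \<le> (1 + h * (c + \<eta>)) * N e"
      using D(1) by (rule mult_right_mono)
    also have "\<dots> = N e + h * (c * N e + \<eta> * N e)"
      by (simp add: algebra_simps)
    also have "\<dots> \<le> N e + h * (c * N e + \<epsilon>)"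
      using elim \<eta>(2) by (simp add: mult_left_mono)
    finally show ?case
      using induced_matrix_norm_le[OF N, of "mat 1 + h *\<^sub>R A" e] by (simp add: mat_1_scaleR_mult_vec)
  qed
qed

text \<open>By the triangle inequality, perturbing the direction by \<open>w\<close> costs at most
  \<open>N w\<close>. This serves both for closedness of the set of directions and for the forcing
  term of the system.\<close>

lemma dir_deriv_le_add:
  fixes N :: "real ^ 'n \<Rightarrow> real"
  assumes N: "vector_norm N" and v: "dir_deriv_le N e v c"
  shows "dir_deriv_le N e (v + w) (c + N w)"
  unfolding dir_deriv_le_def
proof (intro allI impI)
  fix \<epsilon> :: real assume "\<epsilon> > 0"
  note D = vector_normD[OF N]
  have "\<forall>\<^sub>F h in at_right 0. N (e + h *\<^sub>R v) \<le> N e + h * (c + \<epsilon>)"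
    using v \<open>\<epsilon> > 0\<close> by (simp add: dir_deriv_le_def)
  then show "\<forall>\<^sub>F h in at_right 0. N (e + h *\<^sub>R (v + w)) \<le> N e + h * (c + N w + \<epsilon>)"
    using eventually_at_right_less[of 0]
  proof eventually_elim
    case (elim h)
    then show ?case
      using D(4)[of "e + h *\<^sub>R v" "h *\<^sub>R w"] by (simp add: D(3) algebra_simps)
  qed
qed

text \<open>Moving from \<open>e\<close> along a convex combination of directions gives the same
  convex combination of the moved points, to which convexity of \<open>N\<close> applies.\<close>

lemma convex_dir_deriv_le:
  fixes N :: "real ^ 'n \<Rightarrow> real"
  assumes N: "vector_norm N"
  shows "convex {v. dir_deriv_le N e v c}"
proof (rule convexI)
  fix v w :: "real ^ 'n" and a b :: real
  assume vw: "v \<in> {v. dir_deriv_le N e v c}" "w \<in> {v. dir_deriv_le N e v c}"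
    and ab: "0 \<le> a" "0 \<le> b" "a + b = 1"
  note D = vector_normD[OF N]
  have "\<forall>\<^sub>F h in at_right 0. N (e + h *\<^sub>R (a *\<^sub>R v + b *\<^sub>R w)) \<le> N e + h * (c + \<epsilon>)" if "\<epsilon> > 0" for \<epsilon>
  proof -
    have "\<forall>\<^sub>F h in at_right 0. N (e + h *\<^sub>R v) \<le> N e + h * (c + \<epsilon>)"
         "\<forall>\<^sub>F h in at_right 0. N (e + h *\<^sub>R w) \<le> N e + h * (c + \<epsilon>)"
      using vw that by (auto simp: dir_deriv_le_def)
    then show ?thesis
    proof eventually_elim
      case (elim h)
      have "e + h *\<^sub>R (a *\<^sub>R v + b *\<^sub>R w) = (a + b) *\<^sub>R e + h *\<^sub>R (a *\<^sub>R v + b *\<^sub>R w)"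
        by (simp add: ab)
      also have "\<dots> = a *\<^sub>R (e + h *\<^sub>R v) + b *\<^sub>R (e + h *\<^sub>R w)"
        by (simp add: algebra_simps)
      finally have "N (e + h *\<^sub>R (a *\<^sub>R v + b *\<^sub>R w)) \<le> a * N (e + h *\<^sub>R v) + b * N (e + h *\<^sub>R w)"
        using D(4)[of "a *\<^sub>R (e + h *\<^sub>R v)" "b *\<^sub>R (e + h *\<^sub>R w)"] ab by (simp add: D(3))
      also have "\<dots> \<le> N e + h * (c + \<epsilon>)"
        using elim ab by (intro convex_bound_le)
      finally show ?case .
    qed
  qed
  then show "a *\<^sub>R v + b *\<^sub>R w \<in> {v. dir_deriv_le N e v c}"
    by (simp add: dir_deriv_le_def)
qed

lemma closed_dir_deriv_le:
  fixes N :: "real ^ 'n \<Rightarrow> real"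
  assumes N: "vector_norm N"
  shows "closed {v. dir_deriv_le N e v c}"
proof -
  obtain m M where mM: "m > 0" "M > 0" "\<And>x. m * norm x \<le> N x" "\<And>x. N x \<le> M * norm x"
    using vector_norm_equiv[OF N] by blast
  have "dir_deriv_le N e v c" if v: "v \<in> closure {v. dir_deriv_le N e v c}" for v
    unfolding dir_deriv_le_def
  proof (intro allI impI)
    fix \<epsilon> :: real assume \<epsilon>: "\<epsilon> > 0"
    \<comment> \<open>The radius is chosen so that the upper norm constant \<open>M\<close> turns it
      into \<open>N (v - w) \<le> \<epsilon> / 2\<close>; the other half is spent on the direction
      \<open>w\<close>.\<close>
    obtain w where w: "dir_deriv_le N e w c" "dist w v < \<epsilon> / (2 * M)"
      using v \<epsilon> mM(2) unfolding closure_approachable by (auto dest!: spec[of _ "\<epsilon> / (2 * M)"])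
    have "N (v - w) \<le> M * dist w v"
      using mM(4)[of "v - w"] by (simp add: dist_norm norm_minus_commute)
    also have "\<dots> \<le> \<epsilon> / 2"
      using w(2) mM(2) by (simp add: field_simps)
    finally have vw: "N (v - w) \<le> \<epsilon> / 2" .
    have "dir_deriv_le N e v (c + N (v - w))"
      using dir_deriv_le_add[OF N w(1), of "v - w"] by simp
    then have "\<forall>\<^sub>F h in at_right 0. N (e + h *\<^sub>R v) \<le> N e + h * (c + N (v - w) + \<epsilon> / 2)"
      using \<epsilon> by (simp add: dir_deriv_le_def)
    then show "\<forall>\<^sub>F h in at_right 0. N (e + h *\<^sub>R v) \<le> N e + h * (c + \<epsilon>)"
      using eventually_at_right_less[of 0]
    proof eventually_elim
      case (elim h)
      have "h * (c + N (v - w) + \<epsilon> / 2) \<le> h * (c + \<epsilon>)"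
        using elim vw by (intro mult_left_mono) auto
      then show ?case
        using elim by linarith
    qed
  qed
  then show ?thesis
    by (metis closure_subset closure_closed mem_Collect_eq subsetI subset_antisym closed_closure)
qed

section \<open>A mean value theorem for closed convex sets\<close>

text \<open>A vector-valued difference quotient need not equal the derivative at any intermediate
  point. If it lay outside \<open>C\<close>, a hyperplane would strictly separate it from
  \<open>C\<close>, and the scalar mean value theorem along the normal \<open>p\<close> would
  contradict this.\<close>

lemma mean_value_closed_convex:
  fixes \<phi> \<phi>' :: "real \<Rightarrow> 'a::euclidean_space"
  assumes C: "closed C" "convex C" and ab: "a < b"
    and der: "\<And>s. a \<le> s \<Longrightarrow> s \<le> b \<Longrightarrow> (\<phi> has_vector_derivative \<phi>' s) (at s)"
    and mem: "\<And>s. a \<le> s \<Longrightarrow> s \<le> b \<Longrightarrow> \<phi>' s \<in> C"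
  shows "(\<phi> b - \<phi> a) /\<^sub>R (b - a) \<in> C"
proof (rule ccontr)
  assume "(\<phi> b - \<phi> a) /\<^sub>R (b - a) \<notin> C"
  then obtain p q where pq: "p \<bullet> ((\<phi> b - \<phi> a) /\<^sub>R (b - a)) < q" "\<forall>x\<in>C. p \<bullet> x > q"
    using separating_hyperplane_closed_point[OF C(2,1)] by blast
  have "((\<lambda>s. p \<bullet> \<phi> s) has_real_derivative p \<bullet> \<phi>' s) (at s)" if "a \<le> s" "s \<le> b" for s
    using bounded_linear.has_vector_derivative[OF bounded_linear_inner_right der[OF that], of p]
    by (simp add: has_real_derivative_iff_has_vector_derivative)
  from MVT2[OF ab this] obtain z where z: "a < z" "z < b" "p \<bullet> \<phi> b - p \<bullet> \<phi> a = (b - a) * (p \<bullet> \<phi>' z)"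
    by blast
  have "p \<bullet> \<phi>' z > q"
    using pq(2) mem z by simp
  moreover have "p \<bullet> ((\<phi> b - \<phi> a) /\<^sub>R (b - a)) = p \<bullet> \<phi>' z"
    using z(3) ab by (simp add: inner_diff_right)
  ultimately show False
    using pq(1) by simp
qed

text \<open>Along the segment from \<open>y\<close> to \<open>x\<close>, the velocity of
  \<open>F\<close> is the Jacobian applied to the constant vector \<open>x - y\<close>. Hence every
  velocity lies in one and the same closed convex set of directions, and so does their mean.\<close>

lemma dir_deriv_le_diff:
  fixes N :: "real ^ 'n \<Rightarrow> real" and F :: "real ^ 'n \<Rightarrow> real ^ 'n"
  assumes N: "vector_norm N" and F: "\<And>x. F differentiable (at x)"
    and J: "\<And>x. log_norm N (jacobian F (at x)) \<le> c"
  shows "dir_deriv_le N (x - y) (F x - F y) (c * N (x - y))"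
proof -
  let ?C = "{v. dir_deriv_le N (x - y) v (c * N (x - y))}"
  let ?l = "\<lambda>s. y + s *\<^sub>R (x - y)"
  have der: "((\<lambda>s. F (?l s)) has_vector_derivative jacobian F (at (?l s)) *v (x - y)) (at s)" for s
  proof -
    have "(F has_derivative (\<lambda>h. jacobian F (at (?l s)) *v h)) (at (?l s))"
      using F[of "?l s"] by (simp add: jacobian_works)
    moreover have "(?l has_derivative (\<lambda>h. h *\<^sub>R (x - y))) (at s)"
      by (auto intro!: derivative_eq_intros)
    ultimately have "((\<lambda>s. F (?l s)) has_derivative (\<lambda>h. jacobian F (at (?l s)) *v (h *\<^sub>R (x - y)))) (at s)"
      by (rule has_derivative_compose[rotated])
    then show ?thesis
      by (simp add: has_vector_derivative_def matrix_vector_mult_scaleR)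
  qed
  have "(F (?l 1) - F (?l 0)) /\<^sub>R (1 - 0) \<in> ?C"
    using der dir_deriv_le_log_norm[OF N J]
    by (intro mean_value_closed_convex[OF closed_dir_deriv_le[OF N] convex_dir_deriv_le[OF N]]) auto
  then show ?thesis
    by simp
qed

section \<open>Scalar Dini differential inequalities\<close>

text \<open>The curve is replaced by its tangent line. The remainder is of smaller order than
  \<open>s - t\<close>, so its norm is absorbed by one half of \<open>\<epsilon>\<close>, and the
  directional bound on the tangent uses the other half.\<close>

lemma dini_vector_norm:
  fixes N :: "real ^ 'n \<Rightarrow> real" and z :: "real \<Rightarrow> real ^ 'n"
  assumes N: "vector_norm N" and z: "(z has_vector_derivative v) (at_right t)"
    and v: "dir_deriv_le N (z t) v c" and \<epsilon>: "\<epsilon> > 0"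
  shows "\<forall>\<^sub>F s in at_right t. N (z s) \<le> N (z t) + (s - t) * (c + \<epsilon>)"
proof -
  note D = vector_normD[OF N]
  obtain m M where mM: "m > 0" "M > 0" "\<And>x. m * norm x \<le> N x" "\<And>x. N x \<le> M * norm x"
    using vector_norm_equiv[OF N] by blast
  have "\<forall>\<^sub>F s in at_right t. norm (z s - z t - (s - t) *\<^sub>R v) \<le> \<epsilon> / (2 * M) * norm (s - t)"
    using z \<epsilon> mM(2) unfolding has_vector_derivative_def has_derivative_within_alt2
    by (auto dest!: spec[of _ "\<epsilon> / (2 * M)"])
  moreover have "\<forall>\<^sub>F h in at_right 0. N (z t + h *\<^sub>R v) \<le> N (z t) + h * (c + \<epsilon> / 2)"
    using v \<epsilon> by (simp add: dir_deriv_le_def)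
  then have "\<forall>\<^sub>F s in at_right t. N (z t + (s - t) *\<^sub>R v) \<le> N (z t) + (s - t) * (c + \<epsilon> / 2)"
    by (subst eventually_at_right_to_0) simp
  ultimately show ?thesis
    using eventually_at_right_less[of t]
  proof eventually_elim
    case (elim s)
    let ?r = "z s - z t - (s - t) *\<^sub>R v"
    have "N ?r \<le> M * (\<epsilon> / (2 * M) * norm (s - t))"
      using mM(4)[of ?r] elim(1) mM(2) by (meson mult_left_mono less_imp_le order_trans)
    also have "\<dots> = (s - t) * (\<epsilon> / 2)"
      using elim mM(2) by simp
    finally have "N ?r \<le> (s - t) * (\<epsilon> / 2)" .
    moreover have "N (z s) \<le> N (z t + (s - t) *\<^sub>R v) + N ?r"
      using D(4)[of "z t + (s - t) *\<^sub>R v" ?r] by simp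
    ultimately have "N (z s) \<le> N (z t) + (s - t) * (c + \<epsilon> / 2) + (s - t) * (\<epsilon> / 2)"
      using elim by linarith
    then show ?case
      by (simp add: algebra_simps)
  qed
qed

text \<open>At the last time before a violation, \<open>w\<close> either lies strictly below
  \<open>v\<close> or touches it with a strictly smaller upper slope. In both cases \<open>w\<close>
  stays below \<open>v\<close> a little longer.\<close>

lemma dini_comparison:
  fixes w v v' :: "real \<Rightarrow> real"
  assumes w: "continuous_on {T..} w" and init: "w T \<le> v T"
    and v: "\<And>t. t \<ge> T \<Longrightarrow> (v has_real_derivative v' t) (at t)"
    and cross: "\<And>t. t \<ge> T \<Longrightarrow> w t = v t \<Longrightarrow> \<exists>c<v' t. \<forall>\<^sub>F s in at_right t. w s \<le> w t + (s - t) * c"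
    and t: "t \<ge> T"
  shows "w t \<le> v t"
proof (rule ccontr)
  assume "\<not> w t \<le> v t"
  have vc: "continuous_on {T..} v"
    by (rule continuous_at_imp_continuous_on) (auto intro: DERIV_isCont v)
  define S where "S = {s \<in> {T..t}. w s \<le> v s}"
  have "closed S"
    unfolding S_def
    by (intro continuous_on_closed_Collect_le continuous_on_subset[OF w] continuous_on_subset[OF vc]) auto
  moreover have bdd: "bdd_above S"
    unfolding S_def by (rule bdd_aboveI[of _ t]) auto
  moreover have "T \<in> S"
    using init t by (auto simp: S_def)
  ultimately have "Sup S \<in> S"
    using closed_contains_Sup by blast
  define s where "s = Sup S"
  then have "s \<in> S"
    using \<open>Sup S \<in> S\<close> by simp
  then have s: "T \<le> s" "s < t" "w s \<le> v s"
    using \<open>\<not> w t \<le> v t\<close> unfolding S_def by (auto simp: less_le)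
  \<comment> \<open>This suffices: it puts a time later than \<open>Sup S\<close> into
    \<open>S\<close>.\<close>
  have "\<forall>\<^sub>F r in at_right s. w r \<le> v r"
  proof (cases "w s = v s")
    case False
    have "((\<lambda>r. v r - w r) \<longlongrightarrow> v s - w s) (at s within {T..})"
      using w vc s by (intro tendsto_diff) (auto simp: continuous_on_def)
    then have "((\<lambda>r. v r - w r) \<longlongrightarrow> v s - w s) (at_right s)"
      by (rule tendsto_within_subset) (use s in auto)
    then have "\<forall>\<^sub>F r in at_right s. 0 < v r - w r"
      using False s by (intro order_tendstoD(1)) auto
    then show ?thesis
      by eventually_elim simp
  next
    case True
    then obtain c where c: "c < v' s" "\<forall>\<^sub>F r in at_right s. w r \<le> w s + (r - s) * c"
      using cross[OF s(1)] by blast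
    have "(v has_real_derivative v' s) (at_right s)"
      using v[OF s(1)] by (rule has_field_derivative_at_within)
    then have "((\<lambda>r. (v r - v s) / (r - s)) \<longlongrightarrow> v' s) (at_right s)"
      by (simp add: has_field_derivative_iff)
    then have "\<forall>\<^sub>F r in at_right s. c < (v r - v s) / (r - s)"
      using c(1) by (rule order_tendstoD(1))
    then show ?thesis
      using c(2) eventually_at_right_less[of s]
    proof eventually_elim
      case (elim r)
      then have "(r - s) * c \<le> v r - v s"
        by (simp add: field_simps)
      then show ?case
        using elim True by linarith
    qed
  qed
  moreover have "\<forall>\<^sub>F r in at_right s. r \<in> {s<..<t}"
    using s by (intro eventually_at_right_real)
  ultimately have "\<forall>\<^sub>F r in at_right s. r \<in> S \<and> s < r"
    by eventually_elim (use s in \<open>auto simp: S_def\<close>)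
  then obtain r where "r \<in> S" "s < r"
    using eventually_happens' by force
  then show False
    using cSup_upper[OF _ bdd] by (force simp: s_def)
qed

text \<open>The differential inequality is demanded only where \<open>w\<close> is positive. The
  supersolution used for comparison is positive everywhere, so contact happens only at such
  times.\<close>

lemma dini_exp_decay:
  fixes w :: "real \<Rightarrow> real"
  assumes a: "a > 0" and w: "continuous_on {T..} w" and B: "0 \<le> B" "w T \<le> B"
    and dini: "\<And>t \<epsilon>. t \<ge> T \<Longrightarrow> w t > 0 \<Longrightarrow> \<epsilon> > 0 \<Longrightarrow>
       \<forall>\<^sub>F s in at_right t. w s \<le> w t + (s - t) * (- a * w t + \<epsilon>)"
    and t: "t \<ge> T"
  shows "w t \<le> exp (- a * (t - T)) * B"
proof (rule field_le_epsilon)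
  fix \<epsilon> :: real assume \<epsilon>: "\<epsilon> > 0"
  define v where "v = (\<lambda>s. exp (- a * (s - T)) * B + \<epsilon>)"
  \<comment> \<open>The shifted exponential satisfies \<open>v' = - a * v + a * \<epsilon>\<close>.
    At a contact point its slope exceeds \<open>- a * w s\<close> by \<open>a * \<epsilon>\<close>,
    and giving half of this gap to the Dini bound keeps the inequality strict.\<close>
  define v' where "v' = (\<lambda>s. - a * (v s - \<epsilon>))"
  have "w t \<le> v t"
  proof (rule dini_comparison[OF w _ _ _ t])
    show "w T \<le> v T"
      using B \<epsilon> by (simp add: v_def)
    show "(v has_real_derivative v' s) (at s)" for s
      unfolding v_def v'_def by (auto intro!: derivative_eq_intros)
    show "\<exists>c<v' s. \<forall>\<^sub>F r in at_right s. w r \<le> w s + (r - s) * c" if "s \<ge> T" "w s = v s" for s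
    proof (intro exI conjI)
      have "v s > 0"
        using B \<epsilon> by (simp add: v_def add_nonneg_pos)
      then show "\<forall>\<^sub>F r in at_right s. w r \<le> w s + (r - s) * (- a * w s + a * \<epsilon> / 2)"
        using that a \<epsilon> by (intro dini) auto
      have "a * \<epsilon> > 0"
        using a \<epsilon> by simp
      then show "- a * w s + a * \<epsilon> / 2 < v' s"
        using that by (simp add: v'_def algebra_simps)
    qed
  qed
  then show "w t \<le> exp (- a * (t - T)) * B + \<epsilon>"
    by (simp add: v_def)
qed

section \<open>The exponential comparison function and basic facts on solutions\<close>

text \<open>This is the witness for \<open>GIS\<close>; its limit in \<open>s\<close> is used again
  for convergence to 0.\<close>

lemma class_KL_exp:
  assumes "a > 0"
  shows "class_KL (\<lambda>r s. exp (- a * s) * r)"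
proof -
  have "((\<lambda>s. exp (- a * s) * r) \<longlongrightarrow> 0) at_top" for r
  proof -
    have "filterlim (\<lambda>s. - a * s) at_bot at_top"
      using assms by (intro filterlim_tendsto_neg_mult_at_bot[OF tendsto_const]) (auto intro: filterlim_ident)
    then have "((\<lambda>s. exp (- a * s)) \<longlongrightarrow> 0) at_top"
      by (rule filterlim_compose[OF exp_at_bot])
    then show ?thesis
      by (rule tendsto_mult_left_zero)
  qed
  moreover have "antimono_on {0..} (\<lambda>s. exp (- a * s) * r)" if "r \<ge> 0" for r
    using assms that by (auto intro!: monotone_onI mult_right_mono)
  ultimately show ?thesis
    unfolding class_KL_def
    by (auto intro!: strict_mono_onI continuous_intros simp: case_prod_unfold)
qed

lemma solution_continuous_on:
  assumes "solution g t0 x"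
  shows "continuous_on {t0..} x"
  using assms unfolding solution_def
  by (auto intro: has_vector_derivative_continuous simp: continuous_on_eq_continuous_within)

lemma solution_at_right:
  assumes "solution g t0 x" "t \<ge> t0"
  shows "(x has_vector_derivative g (x t) t) (at_right t)"
  using assms unfolding solution_def by (auto intro: has_vector_derivative_within_subset)

lemma C1_in_x_dir_deriv_le:
  assumes "C1_in_x f t0" "vector_norm N" "t \<ge> t0" "\<And>x. log_norm N (jacobian_x f x t) \<le> - a"
  shows "dir_deriv_le N (x - y) (f x t - f y t) (- a * N (x - y))"
  using assms dir_deriv_le_diff[of N "\<lambda>x. f x t" "- a" x y]
  by (simp add: C1_in_x_def jacobian_x_def)

theorem theorem1:
  fixes N :: "real ^ 'n \<Rightarrow> real"
    and f :: "real ^ 'n \<Rightarrow> real \<Rightarrow> real ^ 'n"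
    and \<delta> :: "real \<Rightarrow> real ^ 'n"
    and g :: "real ^ 'n \<Rightarrow> real \<Rightarrow> real ^ 'n"
    and \<alpha> :: "real \<Rightarrow> real"
    and \<alpha>0 t0 :: real
  defines "g \<equiv> (\<lambda>x t. f x t + \<delta> t)"
  assumes "C1_in_x f t0"
    and "\<And>x. continuous_on {t0..} (f x)"
    and "continuous_on {t0..} \<delta>"
    and "uniquely_solvable g t0"
    and "vector_norm N"
    and "continuous_on {t0..} \<alpha>"
    and "\<alpha>0 > 0"
    and "\<And>x t. t \<ge> t0 \<Longrightarrow> log_norm N (jacobian_x f x t) \<le> - \<alpha> t \<and> - \<alpha> t \<le> - \<alpha>0"
  shows "(\<forall>x y. solution g t0 x \<and> solution g t0 y \<longrightarrow>
            (\<forall>t\<ge>t0. N (x t - y t) \<le> exp (- \<alpha>0 * (t - t0)) * N (x t0 - y t0)))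
       \<and> GIS N g t0
       \<and> (((\<lambda>t. N (f 0 t + \<delta> t) / \<alpha> t) \<longlongrightarrow> 0) at_top \<longrightarrow>
            (\<forall>x. solution g t0 x \<longrightarrow> (x \<longlongrightarrow> 0) at_top))"
proof (intro conjI)
  note C1 = assms(2) and N = assms(6) and \<alpha>0 = assms(8) and A1 = assms(9)
  note D = vector_normD[OF N]
  have Ncont: "continuous_on S (\<lambda>t. N (z t))" if "continuous_on S z" for S :: "real set" and z
    using continuous_on_compose2[OF continuous_on_vector_norm[OF N] that] by simp
  \<comment> \<open>The time-dependent rate \<open>\<alpha> t\<close> is kept here, because (A2)
    measures the forcing relative to it.\<close>
  have dd: "dir_deriv_le N (x - y) (f x t - f y t) (- \<alpha> t * N (x - y))" if "t \<ge> t0" for x y t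
    by (rule C1_in_x_dir_deriv_le[OF C1 N that]) (use A1 that in auto)

  have contr: "N (x t - y t) \<le> exp (- \<alpha>0 * (t - t0)) * N (x t0 - y t0)"
    if sol: "solution g t0 x" "solution g t0 y" and t: "t \<ge> t0" for x y t
  proof (rule dini_exp_decay[OF \<alpha>0 _ _ _ _ t])
    show "continuous_on {t0..} (\<lambda>t. N (x t - y t))"
      by (intro Ncont continuous_intros solution_continuous_on[OF sol(1)] solution_continuous_on[OF sol(2)])
    show "\<forall>\<^sub>F r in at_right s. N (x r - y r) \<le> N (x s - y s) + (r - s) * (- \<alpha>0 * N (x s - y s) + \<epsilon>)"
      if s: "s \<ge> t0" and \<epsilon>: "\<epsilon> > 0" for s \<epsilon>
    proof -
      have "((\<lambda>r. x r - y r) has_vector_derivative g (x s) s - g (y s) s) (at_right s)"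
        by (intro has_vector_derivative_diff solution_at_right[OF sol(1) s] solution_at_right[OF sol(2) s])
      then have "((\<lambda>r. x r - y r) has_vector_derivative f (x s) s - f (y s) s) (at_right s)"
        by (simp add: g_def)
      from dini_vector_norm[OF N this dd[OF s] \<epsilon>]
      have ev: "\<forall>\<^sub>F r in at_right s. N (x r - y r) \<le> N (x s - y s) + (r - s) * (- \<alpha> s * N (x s - y s) + \<epsilon>)" .
      have le: "- \<alpha> s * N (x s - y s) \<le> - \<alpha>0 * N (x s - y s)"
        using A1[OF s] D(1) by (intro mult_right_mono) auto
      show ?thesis
        using ev eventually_at_right_less[of s]
        by eventually_elim (use le in \<open>smt (verit) mult_left_mono\<close>)
    qed
  qed (auto simp: D)
  then show "\<forall>x y. solution g t0 x \<and> solution g t0 y \<longrightarrow>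
      (\<forall>t\<ge>t0. N (x t - y t) \<le> exp (- \<alpha>0 * (t - t0)) * N (x t0 - y t0))"
    by blast
  show "GIS N g t0"
    unfolding GIS_def using class_KL_exp[OF \<alpha>0] contr by blast

  show "((\<lambda>t. N (f 0 t + \<delta> t) / \<alpha> t) \<longlongrightarrow> 0) at_top \<longrightarrow> (\<forall>x. solution g t0 x \<longrightarrow> (x \<longlongrightarrow> 0) at_top)"
  proof (intro impI allI)
    fix x
    assume A2: "((\<lambda>t. N (f 0 t + \<delta> t) / \<alpha> t) \<longlongrightarrow> 0) at_top" and sol: "solution g t0 x"
    have ev: "\<forall>\<^sub>F t in at_top. N (x t) < \<rho>" if \<rho>: "\<rho> > 0" for \<rho>
    proof -
      \<comment> \<open>One half of \<open>\<rho>\<close> is the level that the forcing can sustain;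
        the other half bounds the decaying transient.\<close>
      define \<eta> where "\<eta> = \<rho> / 2"
      have \<eta>: "\<eta> > 0" "\<eta> < \<rho>"
        using \<rho> by (auto simp: \<eta>_def)
      have "\<forall>\<^sub>F t in at_top. N (f 0 t + \<delta> t) / \<alpha> t < \<eta> \<and> t \<ge> t0"
        using order_tendstoD(2)[OF A2 \<eta>(1)] eventually_ge_at_top[of t0] by eventually_elim simp
      then obtain T where T: "\<And>t. t \<ge> T \<Longrightarrow> N (f 0 t + \<delta> t) / \<alpha> t < \<eta> \<and> t \<ge> t0"
        unfolding eventually_at_top_linorder by blast
      \<comment> \<open>Truncation at 0 supplies the nonnegative bound required by
        \<open>dini_exp_decay\<close>.\<close>
      define B where "B = max 0 (N (x T) - \<eta>)"
      have decay: "N (x t) - \<eta> \<le> exp (- \<alpha>0 * (t - T)) * B" if t: "t \<ge> T" for t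
      proof (rule dini_exp_decay[OF \<alpha>0 _ _ _ _ t])
        show "continuous_on {T..} (\<lambda>t. N (x t) - \<eta>)"
          by (intro continuous_intros Ncont continuous_on_subset[OF solution_continuous_on[OF sol]])
            (use T in auto)
        show "\<forall>\<^sub>F r in at_right s. N (x r) - \<eta> \<le> N (x s) - \<eta> + (r - s) * (- \<alpha>0 * (N (x s) - \<eta>) + \<epsilon>)"
          if s: "s \<ge> T" and pos: "N (x s) - \<eta> > 0" and \<epsilon>: "\<epsilon> > 0" for s \<epsilon>
        proof -
          have s0: "s \<ge> t0"
            using T s by blast
          have \<alpha>: "\<alpha>0 \<le> \<alpha> s" "\<alpha> s > 0"
            using A1[OF s0, of 0] \<alpha>0 by auto
          \<comment> \<open>The solution is compared with the constant 0, which need not be a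
            solution: \<open>?b\<close> is the value of the right-hand side at 0 and enters the
            estimate as the additive term \<open>N ?b\<close>.\<close>
          let ?b = "f 0 s + \<delta> s"
          have "dir_deriv_le N (x s) (f (x s) s - f 0 s + ?b) (- \<alpha> s * N (x s) + N ?b)"
            using dir_deriv_le_add[OF N dd[OF s0, of "x s" 0], of ?b] by simp
          then have "dir_deriv_le N (x s) (g (x s) s) (- \<alpha> s * N (x s) + N ?b)"
            by (simp add: g_def)
          from dini_vector_norm[OF N solution_at_right[OF sol s0] this \<epsilon>]
          have ev: "\<forall>\<^sub>F r in at_right s. N (x r) \<le> N (x s) + (r - s) * (- \<alpha> s * N (x s) + N ?b + \<epsilon>)" .
          \<comment> \<open>By the choice of \<open>T\<close>, the forcing is at most
            \<open>\<alpha> s * \<eta>\<close>, which shifts the norm by \<open>\<eta>\<close>.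
            Lowering the rate from \<open>\<alpha> s\<close> to \<open>\<alpha>0\<close> is then
            sound because the excess over \<open>\<eta>\<close> is positive.\<close>
          have le: "- \<alpha> s * N (x s) + N ?b \<le> - \<alpha>0 * (N (x s) - \<eta>)"
          proof -
            have "N ?b \<le> \<alpha> s * \<eta>"
              using T[OF s] \<alpha> by (simp add: field_simps)
            then have "- \<alpha> s * N (x s) + N ?b \<le> - \<alpha> s * (N (x s) - \<eta>)"
              by (simp add: algebra_simps)
            also have "\<dots> \<le> - \<alpha>0 * (N (x s) - \<eta>)"
              using \<alpha> pos by (intro mult_right_mono) auto
            finally show ?thesis .
          qed
          show ?thesis
            using ev eventually_at_right_less[of s]
            by eventually_elim (use le in \<open>smt (verit) mult_left_mono\<close>)
        qed
      qed (auto simp: B_def)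
      have "((\<lambda>s. exp (- \<alpha>0 * s) * B) \<longlongrightarrow> 0) at_top"
        using class_KL_exp[OF \<alpha>0] by (simp add: class_KL_def B_def)
      moreover have "filterlim (\<lambda>t. t - T) at_top at_top"
        using filterlim_tendsto_add_at_top[OF tendsto_const[of "- T"] filterlim_ident] by simp
      ultimately have "((\<lambda>t. exp (- \<alpha>0 * (t - T)) * B) \<longlongrightarrow> 0) at_top"
        by (rule filterlim_compose)
      then have "\<forall>\<^sub>F t in at_top. exp (- \<alpha>0 * (t - T)) * B < \<rho> - \<eta>"
        using \<eta> by (intro order_tendstoD(2)) auto
      then show ?thesis
        using eventually_ge_at_top[of T]
        by eventually_elim (use decay in fastforce)
    qed
    \<comment> \<open>The lower equivalence constant turns convergence in \<open>N\<close> into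
      convergence in the Euclidean norm.\<close>
    obtain m M where mM: "m > 0" "\<And>x. m * norm x \<le> N x"
      using vector_norm_equiv[OF N] by metis
    show "(x \<longlongrightarrow> 0) at_top"
    proof (rule tendstoI)
      fix \<epsilon> :: real assume "\<epsilon> > 0"
      then have "\<forall>\<^sub>F t in at_top. N (x t) < m * \<epsilon>"
        using mM(1) by (intro ev) auto
      then show "\<forall>\<^sub>F t in at_top. dist (x t) 0 < \<epsilon>"
      proof eventually_elim
        case (elim t)
        then have "m * norm (x t) < m * \<epsilon>"
          using mM(2)[of "x t"] by linarith
        then show ?case
          using mM(1) by simp
      qed
    qed
  qed
qed

end
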